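(* Let $\mathcal{G}$ be a finite simple graph of order $p=|V(\mathcal{G})|$ with $|e(\mathcal{G})|$ edges and first Zagreb index $M_1(\mathcal{G})$. Then both $LE_{CN}(\mathcal{G})$ and $LE^+_{CN}(\mathcal{G})$ are at most $2\left(1-\frac1p\right)\big(M_1(\mathcal{G})-2|e(\mathcal{G})|\big)$.
   Context: For $\mathcal{G}$ on vertices $v_1,\dots,v_p$: $M_1(\mathcal{G})=\sum_i d(v_i)^2$; $\mathrm{CN}(\mathcal{G})$ has $(i,j)$-entry $|N(v_i)\cap N(v_j)|$ for $i\neq j$ (open neighbourhoods) and $0$ on the diagonal; $\mathrm{CNRS}(\mathcal{G})$ is the diagonal matrix of its row sums; $\mathrm{CNL}=\mathrm{CNRS}-\mathrm{CN}$, $\mathrm{CNSL}=\mathrm{CNRS}+\mathrm{CN}$; $LE_{CN}(\mathcal{G})=\sum_\nu|\nu-tr(\mathrm{CNRS}(\mathcal{G}))/p|$ over eigenvalues of $\mathrm{CNL}(\mathcal{G})$ with multiplicity, and $LE^+_{CN}(\mathcal{G})$ likewise with $\mathrm{CNSL}(\mathcal{G})$. *)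

theory Defs
  imports
    "Graph_Theory.Pair_Digraph"
    "Jordan_Normal_Form.Char_Poly"
    "HOL-Computational_Algebra.Fundamental_Theorem_Algebra"
begin

text \<open>
  A finite simple graph is a \<open>pair_graph\<close>: a finite vertex set \<open>pverts G\<close> with a symmetric,
  loop-free adjacency relation \<open>parcs G\<close> on it.  Every undirected edge corresponds to two opposite
  arcs, so the edges are counted as the unordered pairs \<open>{u, v}\<close>.
\<close>

definition uedges :: "'a pair_pre_digraph \<Rightarrow> 'a set set" where
  "uedges G = (\<lambda>(u, v). {u, v}) ` parcs G"

definition nbhd :: "'a pair_pre_digraph \<Rightarrow> 'a \<Rightarrow> 'a set" where
  "nbhd G v = {w. (v, w) \<in> parcs G}"

definition first_zagreb :: "'a pair_pre_digraph \<Rightarrow> nat" where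
  "first_zagreb G = (\<Sum>v\<in>pverts G. (card (nbhd G v))\<^sup>2)"

definition gorder :: "'a pair_pre_digraph \<Rightarrow> nat" where
  "gorder G = card (pverts G)"

text \<open>
  The matrices are taken with respect to a labelling \<open>v\<close> of the vertices by the indices
  \<open>0, \<dots>, p - 1\<close>, where \<open>p = gorder G\<close>; that \<open>v\<close> is a bijection onto the vertex set is a
  hypothesis wherever they are used.
\<close>

definition CN :: "'a pair_pre_digraph \<Rightarrow> (nat \<Rightarrow> 'a) \<Rightarrow> real mat" where
  "CN G v = mat (gorder G) (gorder G)
     (\<lambda>(i, j). if i = j then 0 else real (card (nbhd G (v i) \<inter> nbhd G (v j))))"

definition CNRS :: "'a pair_pre_digraph \<Rightarrow> (nat \<Rightarrow> 'a) \<Rightarrow> real mat" where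
  "CNRS G v = mat (gorder G) (gorder G)
     (\<lambda>(i, j). if i = j then (\<Sum>k<gorder G. CN G v $$ (i, k)) else 0)"

definition CNL :: "'a pair_pre_digraph \<Rightarrow> (nat \<Rightarrow> 'a) \<Rightarrow> real mat" where
  "CNL G v = CNRS G v - CN G v"

definition CNSL :: "'a pair_pre_digraph \<Rightarrow> (nat \<Rightarrow> 'a) \<Rightarrow> real mat" where
  "CNSL G v = CNRS G v + CN G v"

definition mat_trace :: "'b::comm_monoid_add mat \<Rightarrow> 'b" where
  "mat_trace A = (\<Sum>i<dim_row A. A $$ (i, i))"

text \<open>
  Eigenvalues with multiplicity, as the complex roots of the characteristic polynomial.  Over the
  complex numbers there are always exactly \<open>n\<close> of them, so none can be lost; for the symmetric
  matrices above they are in fact real, and \<open>cmod\<close> below is the absolute value.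
\<close>

definition eigenvalue_mset :: "real mat \<Rightarrow> complex multiset" where
  "eigenvalue_mset A = proots (char_poly (map_mat complex_of_real A))"

lemma size_eigenvalue_mset:
  assumes "A \<in> carrier_mat n n"
  shows "size (eigenvalue_mset A) = n"
proof -
  have "map_mat complex_of_real A \<in> carrier_mat n n"
    using assms by simp
  then show ?thesis
    unfolding eigenvalue_mset_def size_proots_complex
    using degree_monic_char_poly by blast
qed

definition LE_CN :: "'a pair_pre_digraph \<Rightarrow> (nat \<Rightarrow> 'a) \<Rightarrow> real" where
  "LE_CN G v = (\<Sum>\<nu>\<in>#eigenvalue_mset (CNL G v).
     cmod (\<nu> - complex_of_real (mat_trace (CNRS G v) / real (gorder G))))"

definition LE_CN_plus :: "'a pair_pre_digraph \<Rightarrow> (nat \<Rightarrow> 'a) \<Rightarrow> real" where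
  "LE_CN_plus G v = (\<Sum>\<nu>\<in>#eigenvalue_mset (CNSL G v).
     cmod (\<nu> - complex_of_real (mat_trace (CNRS G v) / real (gorder G))))"

end

theory Submission
  imports Defs "Jordan_Normal_Form.Schur_Decomposition"
begin

text \<open>
  Both matrices have the quadratic form \<open>1/2 \<Sum> c\<^sub>i\<^sub>j |x\<^sub>i \<plusminus> x\<^sub>j|\<^sup>2\<close>, where the \<open>c\<^sub>i\<^sub>j\<close> are the
  entries of \<open>CN\<close>, so their eigenvalues are real and nonnegative.  The sum of the eigenvalues is
  the trace \<open>T\<close> of \<open>CNRS\<close>, since \<open>CN\<close> has zero diagonal; and \<open>p\<close> nonnegative reals with
  sum \<open>T\<close> deviate from their mean by at most \<open>2 (1 - 1/p) T\<close> in total.  Finally \<open>T\<close> counts the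
  paths \<open>u - w - u'\<close> with \<open>u \<noteq> u'\<close> by their centre \<open>w\<close>, so
  \<open>T = \<Sum>\<^sub>w d(w) (d(w) - 1) = M\<^sub>1 - 2 |e|\<close>.
\<close>

section \<open>Trace, eigenvalues and eigenvectors\<close>

lemma mat_trace_mult_comm:
  fixes A :: "'b::comm_semiring_0 mat"
  assumes "A \<in> carrier_mat n m" "B \<in> carrier_mat m n"
  shows "mat_trace (A * B) = mat_trace (B * A)"
proof -
  have "mat_trace (A * B) = (\<Sum>i<n. \<Sum>j<m. A $$ (i, j) * B $$ (j, i))"
    using assms by (simp add: mat_trace_def scalar_prod_def atLeast0LessThan)
  also have "\<dots> = (\<Sum>j<m. \<Sum>i<n. B $$ (j, i) * A $$ (i, j))"
    by (subst sum.swap) (simp add: mult.commute)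
  also have "\<dots> = mat_trace (B * A)"
    using assms by (simp add: mat_trace_def scalar_prod_def atLeast0LessThan)
  finally show ?thesis .
qed

lemma mat_trace_similar:
  fixes A B :: "'b::comm_ring_1 mat"
  assumes "similar_mat A B"
  shows "mat_trace A = mat_trace B"
proof -
  obtain n P Q where "{A, B, P, Q} \<subseteq> carrier_mat n n" "Q * P = 1\<^sub>m n" "A = P * B * Q"
    using similar_matD[OF assms] by metis
  then have carr: "B \<in> carrier_mat n n" "P \<in> carrier_mat n n" "Q \<in> carrier_mat n n"
    and QP: "Q * P = 1\<^sub>m n" and A: "A = P * B * Q" by auto
  have "mat_trace A = mat_trace (P * (B * Q))"
    unfolding A using carr by simp
  also have "\<dots> = mat_trace (B * Q * P)"
    using carr by (intro mat_trace_mult_comm) auto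
  also have "B * Q * P = B"
    using carr QP by simp
  finally show ?thesis .
qed

text \<open>Schur triangularisation over the complex numbers: the diagonal of the triangular matrix
  lists the eigenvalues with multiplicity, and similarity preserves the trace.\<close>

lemma sum_eigenvalue_mset:
  assumes A: "A \<in> carrier_mat n n"
  shows "\<Sum>\<^sub># (eigenvalue_mset A) = complex_of_real (mat_trace A)"
proof -
  let ?A = "map_mat complex_of_real A"
  have cA: "?A \<in> carrier_mat n n" using A by simp
  obtain es where es: "char_poly ?A = (\<Prod>a\<leftarrow>es. [:- a, 1:])"
    using char_poly_factorized[OF cA] by blast
  obtain B where B: "B \<in> carrier_mat n n" "upper_triangular B" and sim: "similar_mat ?A B"
    using schur_decomposition_exists[OF cA es] by blast
  have "char_poly ?A = (\<Prod>a\<leftarrow>diag_mat B. [:- a, 1:])"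
    using char_poly_similar[OF sim] char_poly_upper_triangular[OF B] by simp
  moreover have "proots (\<Prod>a\<leftarrow>as. [:- a, 1:]) = mset as" for as :: "complex list"
    by (induction as) (simp_all add: proots_mult prod_list_zero_iff image_iff del: mult_pCons_left)
  ultimately have "eigenvalue_mset A = mset (diag_mat B)"
    by (simp add: eigenvalue_mset_def)
  then have "\<Sum>\<^sub># (eigenvalue_mset A) = mat_trace B"
    by (simp add: sum_mset_sum_list diag_mat_def mat_trace_def sum_unfold_sum_mset atLeast0LessThan)
  also have "\<dots> = mat_trace ?A"
    using mat_trace_similar[OF sim] by simp
  also have "\<dots> = complex_of_real (mat_trace A)"
    using A by (simp add: mat_trace_def)
  finally show ?thesis .
qed

text \<open>The eigenvector is handed over as a function on indices, so that the quadratic form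
  below can be computed with plain finite sums.\<close>

lemma eigenvalue_mset_eigenvector:
  assumes A: "A \<in> carrier_mat n n" and "\<nu> \<in># eigenvalue_mset A"
  obtains x where "\<exists>i<n. x i \<noteq> 0"
    and "\<And>i. i < n \<Longrightarrow> (\<Sum>j<n. complex_of_real (A $$ (i, j)) * x j) = \<nu> * x i"
proof -
  let ?A = "map_mat complex_of_real A"
  have cA: "?A \<in> carrier_mat n n" using A by simp
  have "char_poly ?A \<noteq> 0"
    using degree_monic_char_poly[OF cA] by auto
  then have "poly (char_poly ?A) \<nu> = 0"
    using assms(2) by (simp add: eigenvalue_mset_def)
  then obtain w where w: "w \<in> carrier_vec n" "w \<noteq> 0\<^sub>v n" and Aw: "?A *\<^sub>v w = \<nu> \<cdot>\<^sub>v w"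
    using A by (auto simp: eigenvalue_root_char_poly[OF cA, symmetric] eigenvalue_def eigenvector_def)
  show ?thesis
  proof (rule that[of "\<lambda>i. w $ i"])
    show "\<exists>i<n. w $ i \<noteq> 0" using w by (metis eq_vecI carrier_vecD index_zero_vec)
    fix i assume i: "i < n"
    have "(\<Sum>j<n. complex_of_real (A $$ (i, j)) * w $ j) = (?A *\<^sub>v w) $ i"
      using A w i by (simp add: scalar_prod_def atLeast0LessThan)
    then show "(\<Sum>j<n. complex_of_real (A $$ (i, j)) * w $ j) = \<nu> * w $ i"
      using w i by (simp add: Aw)
  qed
qed

section \<open>Nonnegativity of the spectrum\<close>

text \<open>\<open>s = -1\<close> gives \<open>CNL\<close> and \<open>s = 1\<close> gives \<open>CNSL\<close>.\<close>
lemma eigenvalue_mset_nonneg: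
  fixes c :: "nat \<Rightarrow> nat \<Rightarrow> real" and s :: real
  assumes A: "A = mat n n (\<lambda>(i, j). (if i = j then \<Sum>k<n. c i k else 0) + s * c i j)"
    and s: "s\<^sup>2 = 1"
    and nonneg: "\<And>i j. i < n \<Longrightarrow> j < n \<Longrightarrow> c i j \<ge> 0"
    and sym: "\<And>i j. i < n \<Longrightarrow> j < n \<Longrightarrow> c i j = c j i"
    and \<nu>: "\<nu> \<in># eigenvalue_mset A"
  shows "\<exists>r\<ge>0. \<nu> = complex_of_real r"
proof -
  have cA: "A \<in> carrier_mat n n" by (simp add: A)
  obtain x where x0: "\<exists>i<n. x i \<noteq> 0"
    and ev: "\<And>i. i < n \<Longrightarrow> (\<Sum>j<n. complex_of_real (A $$ (i, j)) * x j) = \<nu> * x i"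
    using eigenvalue_mset_eigenvector[OF cA \<nu>] by blast
  let ?c = "\<lambda>i j. complex_of_real (c i j)" and ?s = "complex_of_real s"
  define D where "D = (\<Sum>i<n. (cmod (x i))\<^sup>2)"
  \<comment> \<open>\<open>q\<close> is twice the Hermitian form of \<open>A\<close> at
    \<open>x\<close>. The goal is \<open>q = 2 * \<nu> * D\<close>; then \<open>q \<ge> 0\<close>
    and \<open>D > 0\<close> settle the claim.\<close>
  define q where "q = (\<Sum>i<n. \<Sum>j<n. c i j * (cmod (x i + ?s * x j))\<^sup>2)"
  have D: "D > 0"
  proof -
    obtain i where "i < n" "x i \<noteq> 0" using x0 by blast
    then show ?thesis unfolding D_def by (intro sum_pos2[of _ i]) auto
  qed
  have row: "(\<Sum>j<n. ?c i j * (x i + ?s * x j)) = \<nu> * x i" if i: "i < n" for i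
  proof -
    have "(\<Sum>j<n. complex_of_real (A $$ (i, j)) * x j)
      = (\<Sum>j<n. (if i = j then (\<Sum>k<n. ?c i k) * x j else 0) + ?c i j * (?s * x j))"
      using i by (intro sum.cong) (auto simp: A algebra_simps)
    also have "\<dots> = (\<Sum>j<n. ?c i j * (x i + ?s * x j))"
      using i by (simp add: sum.distrib distrib_left sum_distrib_right)
    finally show ?thesis using ev[OF i] by simp
  qed
  \<comment> \<open>Pairing the eigenvalue equation with \<open>cnj (x i)\<close> yields one of the
    two equal halves of \<open>q\<close>.\<close>
  have half: "(\<Sum>i<n. \<Sum>j<n. ?c i j * ((x i + ?s * x j) * cnj (x i))) = \<nu> * complex_of_real D"
  proof -
    have "(\<Sum>i<n. \<Sum>j<n. ?c i j * ((x i + ?s * x j) * cnj (x i)))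
      = (\<Sum>i<n. \<nu> * x i * cnj (x i))"
      by (intro sum.cong refl) (simp add: row[symmetric] sum_distrib_right mult.assoc)
    then show ?thesis
      by (simp add: D_def complex_norm_square sum_distrib_left mult.assoc del: of_real_power)
  qed
  have ss: "?s * ?s = 1"
    using s by (simp add: power2_eq_square flip: of_real_mult)
  have "complex_of_real q
    = (\<Sum>i<n. \<Sum>j<n. ?c i j * ((x i + ?s * x j) * cnj (x i)) + ?c i j * ((x j + ?s * x i) * cnj (x j)))"
    unfolding q_def of_real_sum
  proof (intro sum.cong refl)
    fix i j
    \<comment> \<open>Since \<open>s\<close> is real, the cross part carries
      \<open>s * s * x j + s * x i\<close>; with \<open>s * s = 1\<close> it becomes the first part
      with \<open>i\<close> and \<open>j\<close> exchanged.\<close>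
    have "complex_of_real ((cmod (x i + ?s * x j))\<^sup>2)
      = (x i + ?s * x j) * cnj (x i) + (?s * ?s * x j + ?s * x i) * cnj (x j)"
      unfolding complex_norm_square by (simp add: algebra_simps)
    then show "complex_of_real (c i j * (cmod (x i + ?s * x j))\<^sup>2)
      = ?c i j * ((x i + ?s * x j) * cnj (x i)) + ?c i j * ((x j + ?s * x i) * cnj (x j))"
      unfolding ss of_real_mult by (simp only: mult_1_left distrib_left)
  qed
  also have "\<dots> = \<nu> * complex_of_real D
      + (\<Sum>i<n. \<Sum>j<n. ?c i j * ((x j + ?s * x i) * cnj (x j)))"
    by (simp only: sum.distrib half)
  \<comment> \<open>Symmetry of \<open>c\<close> and relabelling the indices turn the second half
    into the first.\<close>
  also have "(\<Sum>i<n. \<Sum>j<n. ?c i j * ((x j + ?s * x i) * cnj (x j)))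
      = (\<Sum>j<n. \<Sum>i<n. ?c j i * ((x j + ?s * x i) * cnj (x j)))"
    by (subst sum.swap) (auto intro!: sum.cong simp: sym)
  finally have "complex_of_real q = \<nu> * complex_of_real (2 * D)"
    using half by simp
  then have "\<nu> = complex_of_real (q / (2 * D))"
    using D by (simp add: field_simps)
  moreover have "q \<ge> 0"
    unfolding q_def by (intro sum_nonneg mult_nonneg_nonneg) (auto simp: nonneg)
  ultimately show ?thesis
    using D by (intro exI[of _ "q / (2 * D)"]) auto
qed

section \<open>Total deviation from the mean\<close>

text \<open>
  Since \<open>\<bar>x - m\<bar> = x + m - 2 min x m\<close>, it suffices that \<open>min x m = m\<close> for some member, and
  some member is at least the mean.
\<close>
lemma sum_mset_abs_diff_mean_le:
  fixes M :: "real multiset"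
  assumes nonneg: "\<And>x. x \<in># M \<Longrightarrow> x \<ge> 0"
  defines "m \<equiv> \<Sum>\<^sub># M / real (size M)"
  shows "(\<Sum>x\<in>#M. \<bar>x - m\<bar>) \<le> 2 * (1 - 1 / real (size M)) * \<Sum>\<^sub># M"
\<comment> \<open>For the empty multiset both sides are 0, since its sum is 0; this covers the graph
  without vertices.\<close>
proof (cases "M = {#}")
  case False
  have tot: "real (size M) * m = \<Sum>\<^sub># M"
    unfolding m_def using False
    by (metis nonzero_mult_div_cancel_left times_divide_eq_right of_nat_eq_0_iff size_eq_0_iff_empty)
  have m0: "m \<ge> 0"
  proof -
    have "\<Sum>\<^sub># N \<ge> 0" if "\<And>x. x \<in># N \<Longrightarrow> x \<ge> 0" for N :: "real multiset"
      using that by (induction N) auto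
    then show ?thesis unfolding m_def using nonneg by simp
  qed
  obtain x where x: "x \<in># M" "x \<ge> m"
  proof (rule ccontr)
    assume "\<not> thesis"
    then have less: "x < m" if "x \<in># M" for x using that \<open>\<And>x. _ \<Longrightarrow> _ \<Longrightarrow> thesis\<close> by fastforce
    have "\<Sum>\<^sub># M < real (size M) * m"
      using False less
    proof (induction M)
      case (add y M)
      \<comment> \<open>The strict inequality fails for the empty multiset, so the singleton has to
        be split off.\<close>
      then show ?case by (cases "M = {#}") (fastforce simp: algebra_simps)+
    qed simp
    with tot show False by simp
  qed
  obtain N where M: "M = add_mset x N" using x by (metis multi_member_split)
  have "(\<Sum>y\<in>#N. \<bar>y - m\<bar>) \<le> \<Sum>\<^sub># N + real (size N) * m"
    using nonneg unfolding M
  proof (induction N)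
    case (add y N)
    have "y \<ge> 0" using add.prems by simp
    then have "\<bar>y - m\<bar> \<le> y + m" using m0 by linarith
    moreover have "(\<Sum>y\<in>#N. \<bar>y - m\<bar>) \<le> \<Sum>\<^sub># N + real (size N) * m"
      using add.prems by (intro add.IH) auto
    ultimately show ?case by (simp add: algebra_simps)
  qed simp
  \<comment> \<open>As \<open>x \<ge> m\<close>, the chosen \<open>x\<close> contributes
    \<open>x - m\<close>, which is \<open>x + m\<close> less \<open>2 * m\<close>; all other members
    are bounded by their value plus \<open>m\<close>.\<close>
  then have "(\<Sum>x\<in>#M. \<bar>x - m\<bar>) \<le> \<Sum>\<^sub># M + real (size M) * m - 2 * m"
    using x by (simp add: M algebra_simps)
  also have "\<dots> = 2 * (1 - 1 / real (size M)) * \<Sum>\<^sub># M"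
    using tot by (simp add: m_def algebra_simps)
  finally show ?thesis .
qed simp

text \<open>The eigenvalues are real and nonnegative, so passing to real parts loses nothing. As
  \<open>c\<close> vanishes on the diagonal, the trace of \<open>A\<close> is \<open>T\<close>,
  which makes \<open>T / n\<close> the mean of the eigenvalues.\<close>

lemma sum_eigenvalue_deviation_le:
  fixes c :: "nat \<Rightarrow> nat \<Rightarrow> real" and s :: real
  assumes A: "A = mat n n (\<lambda>(i, j). (if i = j then \<Sum>k<n. c i k else 0) + s * c i j)"
    and s: "s\<^sup>2 = 1"
    and nonneg: "\<And>i j. i < n \<Longrightarrow> j < n \<Longrightarrow> c i j \<ge> 0"
    and sym: "\<And>i j. i < n \<Longrightarrow> j < n \<Longrightarrow> c i j = c j i"
    and diag: "\<And>i. i < n \<Longrightarrow> c i i = 0"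
    and T: "T = (\<Sum>i<n. \<Sum>j<n. c i j)"
  shows "(\<Sum>\<nu>\<in>#eigenvalue_mset A. cmod (\<nu> - complex_of_real (T / real n)))
    \<le> 2 * (1 - 1 / real n) * T"
proof -
  have cA: "A \<in> carrier_mat n n" by (simp add: A)
  define M where "M = image_mset Re (eigenvalue_mset A)"
  have real: "\<exists>r\<ge>0. \<nu> = complex_of_real r" if "\<nu> \<in># eigenvalue_mset A" for \<nu>
    using eigenvalue_mset_nonneg[OF A s nonneg sym that] by blast
  have size: "size M = n"
    by (simp add: M_def size_eigenvalue_mset[OF cA])
  have "\<Sum>\<^sub># (image_mset Re E) = Re (\<Sum>\<^sub># E)" for E
    by (induction E) simp_all
  then have "\<Sum>\<^sub># M = Re (\<Sum>\<^sub># (eigenvalue_mset A))"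
    by (simp add: M_def)
  also have "\<dots> = T"
    unfolding sum_eigenvalue_mset[OF cA] using diag by (simp add: T mat_trace_def A)
  finally have sumM: "\<Sum>\<^sub># M = T" .
  have "(\<Sum>\<nu>\<in>#eigenvalue_mset A. cmod (\<nu> - complex_of_real (T / real n))) = (\<Sum>x\<in>#M. \<bar>x - T / real n\<bar>)"
    unfolding M_def image_mset.compositionality
  proof (intro arg_cong[where f = sum_mset] image_mset_cong)
    fix \<nu> assume "\<nu> \<in># eigenvalue_mset A"
    then obtain r where "\<nu> = complex_of_real r" using real by blast
    then show "cmod (\<nu> - complex_of_real (T / real n)) = ((\<lambda>x. \<bar>x - T / real n\<bar>) \<circ> Re) \<nu>"
      by (simp flip: of_real_diff of_real_divide)
  qed
  also have "\<dots> \<le> 2 * (1 - 1 / real n) * T"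
    using sum_mset_abs_diff_mean_le[of M] real unfolding size sumM by (fastforce simp: M_def)
  finally show ?thesis .
qed

section \<open>Counting edges and common neighbours\<close>

lemma (in pair_graph) nbhd_subset: "nbhd G x \<subseteq> pverts G"
  using in_arcsD2 by (auto simp: nbhd_def)

lemma (in pair_graph) nbhd_commute: "y \<in> nbhd G x \<longleftrightarrow> x \<in> nbhd G y"
  using arcs_symmetric by (auto simp: nbhd_def)

text \<open>Handshake lemma: the degrees count arcs by their tail, and each edge comes from exactly
  two arcs, distinct because there are no loops.\<close>

lemma (in pair_graph) sum_card_nbhd: "(\<Sum>x\<in>pverts G. card (nbhd G x)) = 2 * card (uedges G)"
proof -
  have "(\<Sum>x\<in>pverts G. card (nbhd G x)) = card (Sigma (pverts G) (nbhd G))"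
    using nbhd_subset finite_subset pair_finite_verts by (subst card_SigmaI) blast+
  also have "Sigma (pverts G) (nbhd G) = parcs G"
    using in_arcsD1 by (auto simp: nbhd_def)
  also have "card (parcs G) = (\<Sum>e\<in>uedges G. card {a \<in> parcs G. (\<lambda>(u, v). {u, v}) a = e})"
    unfolding uedges_def card_eq_sum by (rule sum.image_gen[OF pair_finite_arcs])
  also have "\<dots> = (\<Sum>e\<in>uedges G. 2)"
  proof (intro sum.cong refl)
    fix e assume "e \<in> uedges G"
    then obtain u v where uv: "(u, v) \<in> parcs G" "e = {u, v}" by (auto simp: uedges_def)
    then have "u \<noteq> v" using pair_no_loops by fastforce
    have "{a \<in> parcs G. (\<lambda>(u, v). {u, v}) a = e} = {(u, v), (v, u)}"
      using uv arcs_symmetric by (auto simp: doubleton_eq_iff)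
    then show "card {a \<in> parcs G. (\<lambda>(u, v). {u, v}) a = e} = 2"
      using \<open>u \<noteq> v\<close> by simp
  qed
  finally show ?thesis by simp
qed

text \<open>Double counting of triples \<open>(x, y, z)\<close> with \<open>x\<close> and
  \<open>y\<close> both adjacent to \<open>z\<close>: a fixed \<open>z\<close> admits
  \<open>(card (nbhd G z))\<^sup>2\<close> of them.\<close>

lemma (in pair_graph) sum_card_common_nbhd:
  "(\<Sum>x\<in>pverts G. \<Sum>y\<in>pverts G. card (nbhd G x \<inter> nbhd G y)) = first_zagreb G"
proof -
  let ?V = "pverts G"
  let ?i = "\<lambda>z x. if x \<in> nbhd G z then 1 else 0 :: nat"
  have card: "card (nbhd G z) = (\<Sum>x\<in>?V. ?i z x)" for z
    using nbhd_subset pair_finite_verts by (simp add: sum.If_cases Int_absorb1)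
  have "card (nbhd G x \<inter> nbhd G y) = (\<Sum>z\<in>?V. ?i z x * ?i z y)" for x y
  proof -
    have "(\<Sum>z\<in>?V. ?i z x * ?i z y) = (\<Sum>z\<in>?V. if z \<in> nbhd G x \<inter> nbhd G y then 1 else 0)"
      by (intro sum.cong) (auto simp: nbhd_commute)
    also have "\<dots> = card (?V \<inter> (nbhd G x \<inter> nbhd G y))"
      using pair_finite_verts by (simp add: sum.If_cases del: Int_iff)
    also have "?V \<inter> (nbhd G x \<inter> nbhd G y) = nbhd G x \<inter> nbhd G y"
      using nbhd_subset by blast
    finally show ?thesis by simp
  qed
  then have "(\<Sum>x\<in>?V. \<Sum>y\<in>?V. card (nbhd G x \<inter> nbhd G y))
    = (\<Sum>x\<in>?V. \<Sum>y\<in>?V. \<Sum>z\<in>?V. ?i z x * ?i z y)" by simp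
  also have "\<dots> = (\<Sum>x\<in>?V. \<Sum>z\<in>?V. \<Sum>y\<in>?V. ?i z x * ?i z y)"
    by (intro sum.cong refl sum.swap)
  also have "\<dots> = (\<Sum>z\<in>?V. \<Sum>x\<in>?V. \<Sum>y\<in>?V. ?i z x * ?i z y)"
    by (rule sum.swap)
  also have "\<dots> = first_zagreb G"
    unfolding first_zagreb_def card power2_eq_square by (simp only: sum_product)
  finally show ?thesis .
qed

text \<open>With the diagonal included, the counts would sum to the Zagreb index. Setting the
  diagonal to 0 removes the degree of each vertex, in total twice the number of edges.\<close>

lemma (in pair_graph) sum_CN:
  assumes bij: "bij_betw v {..<gorder G} (pverts G)"
  shows "(\<Sum>i<gorder G. \<Sum>j<gorder G. CN G v $$ (i, j))
    = real (first_zagreb G) - 2 * real (card (uedges G))"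
proof -
  let ?n = "gorder G" and ?d = "\<lambda>x y. real (card (nbhd G x \<inter> nbhd G y))"
  have inner: "(\<Sum>j<?n. CN G v $$ (i, j)) = (\<Sum>y\<in>pverts G. ?d (v i) y) - ?d (v i) (v i)"
    if i: "i < ?n" for i
  proof -
    have "(\<Sum>j<?n. CN G v $$ (i, j)) = (\<Sum>j<?n. ?d (v i) (v j) - (if i = j then ?d (v i) (v j) else 0))"
      using i by (intro sum.cong) (auto simp: CN_def)
    also have "\<dots> = (\<Sum>j<?n. ?d (v i) (v j)) - ?d (v i) (v i)"
      using i by (simp add: sum_subtractf)
    finally show ?thesis by (simp add: sum.reindex_bij_betw[OF bij, of "?d (v i)"])
  qed
  have "(\<Sum>i<?n. \<Sum>j<?n. CN G v $$ (i, j)) = (\<Sum>i<?n. (\<Sum>y\<in>pverts G. ?d (v i) y) - ?d (v i) (v i))"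
    by (simp add: inner)
  also have "\<dots> = (\<Sum>x\<in>pverts G. (\<Sum>y\<in>pverts G. ?d x y) - ?d x x)"
    by (rule sum.reindex_bij_betw[OF bij])
  also have "\<dots> = real (\<Sum>x\<in>pverts G. \<Sum>y\<in>pverts G. card (nbhd G x \<inter> nbhd G y))
      - real (\<Sum>x\<in>pverts G. card (nbhd G x))"
    by (simp add: sum_subtractf)
  finally show ?thesis
    unfolding sum_card_common_nbhd sum_card_nbhd by simp
qed

theorem theorem5p6:
  fixes G :: "'a pair_pre_digraph" and v :: "nat \<Rightarrow> 'a"
  assumes "pair_graph G"
    and "bij_betw v {..<gorder G} (pverts G)"
  shows "LE_CN G v
           \<le> 2 * (1 - 1 / real (gorder G)) * (real (first_zagreb G) - 2 * real (card (uedges G)))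
       \<and> LE_CN_plus G v
           \<le> 2 * (1 - 1 / real (gorder G)) * (real (first_zagreb G) - 2 * real (card (uedges G)))"
proof -
  interpret pair_graph G by fact
  define c where "c i j = CN G v $$ (i, j)" for i j
  let ?n = "gorder G" and ?T = "mat_trace (CNRS G v)"
  have c: "c i j \<ge> 0" "c i j = c j i" "c i i = 0" if "i < ?n" "j < ?n" for i j
    using that by (auto simp: c_def CN_def Int_commute)
  have T: "?T = (\<Sum>i<?n. \<Sum>j<?n. c i j)"
    by (simp add: mat_trace_def CNRS_def c_def)
  \<comment> \<open>The sign is an explicit factor so that both matrices fit the common shape; on
    the diagonal the extra summand is 0 because \<open>c i i = 0\<close>.\<close>
  have L: "CNL G v = mat ?n ?n (\<lambda>(i, j). (if i = j then \<Sum>k<?n. c i k else 0) + (-1) * c i j)"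
    by (rule eq_matI) (auto simp: CNL_def CNRS_def c_def CN_def)
  have S: "CNSL G v = mat ?n ?n (\<lambda>(i, j). (if i = j then \<Sum>k<?n. c i k else 0) + 1 * c i j)"
    by (rule eq_matI) (auto simp: CNSL_def CNRS_def c_def CN_def)
  have "LE_CN G v \<le> 2 * (1 - 1 / real ?n) * ?T" "LE_CN_plus G v \<le> 2 * (1 - 1 / real ?n) * ?T"
    unfolding LE_CN_def LE_CN_plus_def
    using c by (intro sum_eigenvalue_deviation_le[OF L _ _ _ _ T] sum_eigenvalue_deviation_le[OF S _ _ _ _ T]; simp)+
  moreover have "?T = real (first_zagreb G) - 2 * real (card (uedges G))"
    using sum_CN[OF assms(2)] by (simp add: T c_def)
  ultimately show ?thesis by simp
qed

end
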